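(* Let $G=(V,E)$ be a finite simple undirected graph with $m=|E|\ge 1$ edges, and let $\mathcal G$ be a random graph distribution on the vertex set $V$ in which an edge between distinct vertices $i,j$ is present with probability $p_{ij}=p_{ji}$. Let $G'=(V,E')$ be the complete graph on $V$ with real edge weights $$\mathrm{weight}(i,j)=\begin{cases}1-p_{ij}, & \text{if } (i,j)\in E,\\ -p_{ij}, & \text{if } (i,j)\notin E,\end{cases}\qquad i\neq j .$$ Then the problem of finding a partition of $V$ that maximizes the modularity $Q$ of $G$ (with respect to $\mathcal G$) reduces in $O(|V|+|E|)$ time to the problem of finding a minimum weight cut in $G'$. That is, the weighted graph $G'$, with the edges of $E'\setminus E$ represented implicitly, can be constructed from $G$ in $O(|V|+|E|)$ time, and a partition $\mathcal P$ of $V$ maximizes $Q(\mathcal P)$ over all partitions of $V$ if and only if $\mathcal P$ minimizes the weight of its cut in $G'$ over all partitions of $V$.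
   Context: A partition $\mathcal P=\{V_1,\dots,V_k\}$ of $V$ is a partition into nonempty disjoint subsets (clusters) whose union is $V$; the number $k\ge 1$ of clusters is arbitrary and not fixed in advance (in particular $k=1$ is allowed). Modularity: for a partition $\mathcal P=\{V_1,\dots,V_k\}$ of $V$, $$Q(\mathcal P)=\frac1m\sum_{i=1}^k\bigl(|E(V_i)|-\mathrm{Ex}(V_i,\mathcal G)\bigr),$$ where $E(V_i)$ is the set of edges of $G$ with both endpoints in $V_i$, and $\mathrm{Ex}(V_i,\mathcal G)$ is the expected number of edges with both endpoints in $V_i$ in a random graph from $\mathcal G$, i.e. $\mathrm{Ex}(V_i,\mathcal G)=\sum_{\{a,b\}\subseteq V_i,\ a\ne b}p_{ab}$. Cut: the cut of a partition $\mathcal P$ in $G'$ is the set of all edges of $G'$ that join vertices from different sets of $\mathcal P$; its weight is the sum of the weights of these edges (zero if $k=1$). Weights may be negative. The minimum weight cut problem asks for a partition (into any number of parts) whose cut has minimum weight. Time bound: the edges of $E'\setminus E$ and their weights are not listed but are defined implicitly by the rule for $p_{ij}$, where any individual $p_{ij}$ can be evaluated in constant time from data about $G$ computable in $O(|V|+|E|)$ time. Examples of the model $\mathcal G$ are the Erdős–Rényi model, $p_{ij}=m/\binom{n}{2}$ with $n=|V|$, and the Chung–Lu model, $p_{ij}=d_id_j/\sum_{k=1}^n d_k$, where $d_i$ is the degree of vertex $i$ in $G$ (with $\max_i d_i^2<\sum_i d_i$). *)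

theory Defs
  imports "HOL-Probability.Probability" "HOL-Library.Ramsey" "HOL-Library.Disjoint_Sets"
begin

section \<open>Graphs, random graphs, modularity and cuts\<close>

text \<open>Edges are two-element vertex sets, so \<open>nsets V 2\<close> is the edge set of the complete graph.\<close>

definition simple_graph :: "'a set \<Rightarrow> 'a set set \<Rightarrow> bool" where
  "simple_graph V E \<longleftrightarrow> finite V \<and> E \<subseteq> nsets V 2"

text \<open>A random graph on \<open>V\<close> is a distribution of the edge set; no independence is assumed.\<close>

definition random_graph :: "'a set \<Rightarrow> 'a set set pmf \<Rightarrow> bool" where
  "random_graph V \<G> \<longleftrightarrow> set_pmf \<G> \<subseteq> Pow (nsets V 2)"

definition edge_prob :: "'a set set pmf \<Rightarrow> 'a \<Rightarrow> 'a \<Rightarrow> real" where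
  "edge_prob \<G> i j = measure_pmf.prob \<G> {F. {i, j} \<in> F}"

definition edges_within :: "'a set set \<Rightarrow> 'a set \<Rightarrow> 'a set set" where
  "edges_within E U = {e \<in> E. e \<subseteq> U}"

definition Ex :: "'a set \<Rightarrow> 'a set set pmf \<Rightarrow> real" where
  "Ex U \<G> = measure_pmf.expectation \<G> (\<lambda>F. real (card (edges_within F U)))"

definition modularity :: "'a set set \<Rightarrow> 'a set set pmf \<Rightarrow> 'a set set \<Rightarrow> real" where
  "modularity E \<G> P = 1 / real (card E) * (\<Sum>U\<in>P. real (card (edges_within E U)) - Ex U \<G>)"

definition weight :: "'a set set \<Rightarrow> 'a set set pmf \<Rightarrow> 'a \<Rightarrow> 'a \<Rightarrow> real" where
  "weight E \<G> i j = (if {i, j} \<in> E then 1 - edge_prob \<G> i j else - edge_prob \<G> i j)"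

definition edge_weight :: "'a set set \<Rightarrow> 'a set set pmf \<Rightarrow> 'a set \<Rightarrow> real" where
  "edge_weight E \<G> e = (THE w. \<exists>i j. e = {i, j} \<and> w = weight E \<G> i j)"

lemma edge_weight_pair: "edge_weight E \<G> {i, j} = weight E \<G> i j"
  unfolding edge_weight_def
  by (rule the_equality)
    (auto simp: doubleton_eq_iff weight_def edge_prob_def insert_commute)

definition cut :: "'a set \<Rightarrow> 'a set set \<Rightarrow> 'a set set" where
  "cut V P = {e \<in> nsets V 2. \<exists>A\<in>P. \<exists>B\<in>P. A \<noteq> B \<and> (\<exists>i\<in>A. \<exists>j\<in>B. e = {i, j})}"

definition cut_weight :: "'a set \<Rightarrow> 'a set set \<Rightarrow> 'a set set pmf \<Rightarrow> 'a set set \<Rightarrow> real" where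
  "cut_weight V E \<G> P = (\<Sum>e\<in>cut V P. edge_weight E \<G> e)"


section \<open>A real random access machine\<close>

text \<open>
  Running times refer to a unit-cost real RAM with finitely many named arrays of natural numbers
  and finitely many named arrays of reals, written as a structured language. A scalar variable is
  cell 0 of an array. Natural numbers (addresses) can be added and subtracted but not multiplied,
  and there is no rounding of reals to natural numbers. Every node of an expression costs one
  step.
\<close>

type_synonym vname = string

record state =
  nmem :: "vname \<Rightarrow> nat \<Rightarrow> nat"
  rmem :: "vname \<Rightarrow> nat \<Rightarrow> real"

datatype nexp = NConst nat | NAt vname nexp | NAdd nexp nexp | NSub nexp nexp

datatype rexp = RConst real | RAt vname nexp | ROfNat nexp
  | RAdd rexp rexp | RSub rexp rexp | RMul rexp rexp | RDiv rexp rexp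

datatype bexp = NLess nexp nexp | RLess rexp rexp | BNot bexp | BAnd bexp bexp

datatype com = Skip | NAssign vname nexp nexp | RAssign vname nexp rexp
  | Seq com com | If bexp com com | While bexp com

primrec nval :: "nexp \<Rightarrow> state \<Rightarrow> nat" where
  "nval (NConst k) s = k"
| "nval (NAt x a) s = nmem s x (nval a s)"
| "nval (NAdd a b) s = nval a s + nval b s"
| "nval (NSub a b) s = nval a s - nval b s"

primrec rval :: "rexp \<Rightarrow> state \<Rightarrow> real" where
  "rval (RConst r) s = r"
| "rval (RAt x a) s = rmem s x (nval a s)"
| "rval (ROfNat a) s = real (nval a s)"
| "rval (RAdd a b) s = rval a s + rval b s"
| "rval (RSub a b) s = rval a s - rval b s"
| "rval (RMul a b) s = rval a s * rval b s"
| "rval (RDiv a b) s = rval a s / rval b s"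

primrec bval :: "bexp \<Rightarrow> state \<Rightarrow> bool" where
  "bval (NLess a b) s = (nval a s < nval b s)"
| "bval (RLess a b) s = (rval a s < rval b s)"
| "bval (BNot b) s = (\<not> bval b s)"
| "bval (BAnd b c) s = (bval b s \<and> bval c s)"

primrec ncost :: "nexp \<Rightarrow> nat" where
  "ncost (NConst k) = 1"
| "ncost (NAt x a) = 1 + ncost a"
| "ncost (NAdd a b) = 1 + ncost a + ncost b"
| "ncost (NSub a b) = 1 + ncost a + ncost b"

primrec rcost :: "rexp \<Rightarrow> nat" where
  "rcost (RConst r) = 1"
| "rcost (RAt x a) = 1 + ncost a"
| "rcost (ROfNat a) = 1 + ncost a"
| "rcost (RAdd a b) = 1 + rcost a + rcost b"
| "rcost (RSub a b) = 1 + rcost a + rcost b"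
| "rcost (RMul a b) = 1 + rcost a + rcost b"
| "rcost (RDiv a b) = 1 + rcost a + rcost b"

primrec bcost :: "bexp \<Rightarrow> nat" where
  "bcost (NLess a b) = 1 + ncost a + ncost b"
| "bcost (RLess a b) = 1 + rcost a + rcost b"
| "bcost (BNot b) = 1 + bcost b"
| "bcost (BAnd b c) = 1 + bcost b + bcost c"

definition nput :: "vname \<Rightarrow> nat \<Rightarrow> nat \<Rightarrow> state \<Rightarrow> state" where
  "nput x k v s = s\<lparr>nmem := (nmem s)(x := (nmem s x)(k := v))\<rparr>"

definition rput :: "vname \<Rightarrow> nat \<Rightarrow> real \<Rightarrow> state \<Rightarrow> state" where
  "rput x k v s = s\<lparr>rmem := (rmem s)(x := (rmem s x)(k := v))\<rparr>"

text \<open>\<open>exec c s t s'\<close>: started in \<open>s\<close>, the program \<open>c\<close> halts in \<open>s'\<close> after \<open>t\<close> steps.\<close>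

inductive exec :: "com \<Rightarrow> state \<Rightarrow> nat \<Rightarrow> state \<Rightarrow> bool" where
  Skip: "exec Skip s 1 s"
| NAssign: "exec (NAssign x a b) s (1 + ncost a + ncost b) (nput x (nval a s) (nval b s) s)"
| RAssign: "exec (RAssign x a b) s (1 + ncost a + rcost b) (rput x (nval a s) (rval b s) s)"
| Seq: "exec c s t s' \<Longrightarrow> exec d s' u s'' \<Longrightarrow> exec (Seq c d) s (t + u) s''"
| IfTrue: "bval b s \<Longrightarrow> exec c s t s' \<Longrightarrow> exec (If b c d) s (1 + bcost b + t) s'"
| IfFalse: "\<not> bval b s \<Longrightarrow> exec d s t s' \<Longrightarrow> exec (If b c d) s (1 + bcost b + t) s'"
| WhileFalse: "\<not> bval b s \<Longrightarrow> exec (While b c) s (1 + bcost b) s"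
| WhileTrue: "bval b s \<Longrightarrow> exec c s t s' \<Longrightarrow> exec (While b c) s' u s'' \<Longrightarrow>
    exec (While b c) s (1 + bcost b + t + u) s''"


section \<open>Graphs and implicit weights in memory\<close>

text \<open>
  On the machine the vertices are \<open>0, ..., n - 1\<close>; \<open>\<nu> i\<close> is the vertex of the graph with number
  \<open>i\<close>. A graph is given by a list of its edges in any order and orientation.
\<close>

definition edge_list :: "(nat \<Rightarrow> 'a) \<Rightarrow> 'a set \<Rightarrow> 'a set set \<Rightarrow> (nat \<times> nat) list \<Rightarrow> bool" where
  "edge_list \<nu> V E es \<longleftrightarrow> set es \<subseteq> {..<card V} \<times> {..<card V} \<and>
     distinct (map (\<lambda>(i, j). {\<nu> i, \<nu> j}) es) \<and> set (map (\<lambda>(i, j). {\<nu> i, \<nu> j}) es) = E"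

definition input_state :: "nat \<Rightarrow> (nat \<times> nat) list \<Rightarrow> state" where
  "input_state n es =
    \<lparr>nmem = (\<lambda>_ _. 0)
       (''n'' := (\<lambda>_. 0)(0 := n),
        ''m'' := (\<lambda>_. 0)(0 := length es),
        ''src'' := (\<lambda>k. if k < length es then fst (es ! k) else 0),
        ''dst'' := (\<lambda>k. if k < length es then snd (es ! k) else 0)),
     rmem = (\<lambda>_ _. 0)\<rparr>"

text \<open>
  \<open>answers q d D f R s\<close>: starting from the memory contents \<open>s\<close>, any sequence of queries
  \<open>(i, j) \<in> D\<close> can be posed, each by writing \<open>i\<close>, \<open>j\<close> to the variables \<open>''i''\<close>, \<open>''j''\<close> and running
  \<open>q\<close>; each is answered within \<open>d\<close> steps by \<open>f i j\<close> in \<open>''out''\<close>, and \<open>R\<close> holds before the first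
  and after every query. Being coinductive, this allows \<open>q\<close> to use scratch memory but not to
  spoil the data for later queries.
\<close>

coinductive answers ::
  "com \<Rightarrow> nat \<Rightarrow> (nat \<times> nat) set \<Rightarrow> (nat \<Rightarrow> nat \<Rightarrow> real) \<Rightarrow> (state \<Rightarrow> bool) \<Rightarrow> state \<Rightarrow> bool"
  for q d D f R where
  "R s \<Longrightarrow>
   (\<And>i j. (i, j) \<in> D \<Longrightarrow> \<exists>t s'. exec q (nput ''i'' 0 i (nput ''j'' 0 j s)) t s' \<and> t \<le> d \<and>
      rmem s' ''out'' 0 = f i j \<and> answers q d D f R s') \<Longrightarrow>
   answers q d D f R s"

text \<open>
  A model assigns to every graph \<open>(V, E)\<close> a random graph on \<open>V\<close>. It is efficient if data
  computable in linear time from \<open>G\<close> allow constant-time evaluation of any individual \<open>p\<^sub>i\<^sub>j\<close>.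
  The programs and the constants are independent of \<open>G\<close>.
\<close>

definition efficient_model ::
  "('a set \<Rightarrow> nat \<Rightarrow> 'a) \<Rightarrow> ('a set \<Rightarrow> 'a set set \<Rightarrow> 'a set set pmf) \<Rightarrow> bool" where
  "efficient_model num model \<longleftrightarrow> (\<exists>pre q c d. \<forall>V E es.
     simple_graph V E \<and> card E \<ge> 1 \<and> edge_list (num V) V E es \<longrightarrow>
     (\<exists>t s. exec pre (input_state (card V) es) t s \<and> t \<le> c * (card V + card E) \<and>
        answers q d {(i, j). i < card V \<and> j < card V \<and> i \<noteq> j}
          (\<lambda>i j. edge_prob (model V E) (num V i) (num V j)) (\<lambda>_. True) s))"

text \<open>
  The explicit part of \<open>G'\<close>: the number of vertices, and the edges in \<open>E\<close> with their weights, are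
  stored in the variables and arrays \<open>xn\<close>, \<open>xm\<close>, \<open>xs\<close>, \<open>xd\<close>, \<open>xw\<close>.
\<close>

definition stores_weighted_edges :: "vname \<Rightarrow> vname \<Rightarrow> vname \<Rightarrow> vname \<Rightarrow> vname \<Rightarrow>
    (nat \<Rightarrow> 'a) \<Rightarrow> 'a set \<Rightarrow> 'a set set \<Rightarrow> ('a \<Rightarrow> 'a \<Rightarrow> real) \<Rightarrow> state \<Rightarrow> bool" where
  "stores_weighted_edges xn xm xs xd xw \<nu> V E w s \<longleftrightarrow>
     nmem s xn 0 = card V \<and> nmem s xm 0 = card E \<and>
     (\<exists>es. edge_list \<nu> V E es \<and>
       (\<forall>k < card E. nmem s xs k = fst (es ! k) \<and> nmem s xd k = snd (es ! k) \<and>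
          rmem s xw k = w (\<nu> (fst (es ! k))) (\<nu> (snd (es ! k)))))"

text \<open>
  The graph \<open>G'\<close> can be constructed from \<open>G\<close> in linear time, its edges outside \<open>E\<close> being
  represented by a constant-time query \<open>q\<close> for their weights.
\<close>

definition linear_time_constructible ::
  "('a set \<Rightarrow> nat \<Rightarrow> 'a) \<Rightarrow> ('a set \<Rightarrow> 'a set set \<Rightarrow> 'a set set pmf) \<Rightarrow> bool" where
  "linear_time_constructible num model \<longleftrightarrow> (\<exists>build q c d xn xm xs xd xw. \<forall>V E es.
     simple_graph V E \<and> card E \<ge> 1 \<and> edge_list (num V) V E es \<longrightarrow>
     (\<exists>t s. exec build (input_state (card V) es) t s \<and> t \<le> c * (card V + card E) \<and>
        answers q d {(i, j). i < card V \<and> j < card V \<and> {num V i, num V j} \<in> nsets V 2 - E}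
          (\<lambda>i j. weight E (model V E) (num V i) (num V j))
          (stores_weighted_edges xn xm xs xd xw (num V) V E (weight E (model V E))) s))"

end

theory Submission
  imports Defs
begin

text \<open>
  By linearity of expectation, the contribution of a cluster to \<open>m \<cdot> Q\<close> is the total weight of the
  edges of \<open>G'\<close> inside the cluster. An edge of \<open>G'\<close> is either cut or inside exactly one cluster, so
  \<open>m \<cdot> Q(P)\<close> and the cut weight of \<open>P\<close> sum to the total weight of \<open>G'\<close>, which does not depend on \<open>P\<close>.
  For the construction in linear time, one copies the edge list to fresh variables, runs the
  preprocessing of the model, and queries the model once for every edge of \<open>G\<close>; the weight of a
  non-edge is a negated model query.
\<close>

section \<open>Modularity and cut weight\<close>

lemma nsets_2E:
  assumes "e \<in> nsets V 2"
  obtains i j where "i \<in> V" "j \<in> V" "i \<noteq> j" "e = {i, j}"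
  using assms by (auto simp: nsets_def card_2_iff)

lemma edge_weight_nsets:
  assumes "e \<in> nsets V 2"
  shows "edge_weight E \<G> e = of_bool (e \<in> E) - measure_pmf.prob \<G> {F. e \<in> F}"
  using assms by (elim nsets_2E) (simp add: edge_weight_pair weight_def edge_prob_def)

text \<open>The edge count inside \<open>U\<close> is a sum of indicators over the pairs in
  \<open>U\<close>, so linearity of expectation applies whatever the dependence between
  edges.\<close>

lemma Ex_eq_sum_edge_prob:
  assumes "random_graph V \<G>" "finite V" "U \<subseteq> V"
  shows "Ex U \<G> = (\<Sum>e\<in>nsets U 2. measure_pmf.prob \<G> {F. e \<in> F})"
proof -
  have fin: "finite (nsets U 2)"
    using assms finite_subset finite_imp_finite_nsets by blast
  \<comment> \<open>Only sets in the support are considered: they consist of pairs from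
    \<open>V\<close>, so nothing but pairs is counted inside \<open>U\<close>. The two integrands
    then agree almost everywhere.\<close>
  have "real (card (edges_within F U)) = (\<Sum>e\<in>nsets U 2. indicator {F. e \<in> F} F)"
    if "F \<in> set_pmf \<G>" for F
  proof -
    have "F \<subseteq> nsets V 2" using that assms by (auto simp: random_graph_def)
    then have "edges_within F U = nsets U 2 \<inter> F"
      using assms(3) by (auto simp: edges_within_def nsets_def)
    then show ?thesis
      using fin by (simp add: indicator_def sum.If_cases Int_def)
  qed
  then have "Ex U \<G> = measure_pmf.expectation \<G> (\<lambda>F. \<Sum>e\<in>nsets U 2. indicator {F. e \<in> F} F)"
    unfolding Ex_def by (intro integral_cong_AE) (auto simp: AE_measure_pmf_iff)
  also have "\<dots> = (\<Sum>e\<in>nsets U 2. measure_pmf.expectation \<G> (indicator {F. e \<in> F}))"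
    by (rule Bochner_Integration.integral_sum)
      (auto intro!: integrable_real_indicator simp: less_top[symmetric])
  finally show ?thesis by simp
qed

text \<open>Disjointness keeps a pair with ends in different clusters out of every single cluster;
  conversely, covering gives each end of a pair inside no cluster a cluster, and the two must
  differ.\<close>

lemma cut_partition:
  assumes "partition_on V P"
  shows "cut V P = nsets V 2 - (\<Union>U\<in>P. nsets U 2)"
proof (intro set_eqI iffI)
  fix e assume "e \<in> cut V P"
  then obtain A B i j where *: "e \<in> nsets V 2" "A \<in> P" "B \<in> P" "A \<noteq> B" "i \<in> A" "j \<in> B" "e = {i, j}"
    unfolding cut_def by blast
  have "\<not> {i, j} \<subseteq> U" if "U \<in> P" for U
  proof
    assume "{i, j} \<subseteq> U"
    then have "i \<in> U \<inter> A" "j \<in> U \<inter> B" using * by auto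
    then have "U = A" "U = B"
      using disjointD[OF partition_onD2[OF assms] \<open>U \<in> P\<close>] *(2,3) by blast+
    with *(4) show False by simp
  qed
  with * show "e \<in> nsets V 2 - (\<Union>U\<in>P. nsets U 2)" by (auto simp: nsets_def)
next
  fix e assume e: "e \<in> nsets V 2 - (\<Union>U\<in>P. nsets U 2)"
  then obtain i j where ij: "i \<in> V" "j \<in> V" "i \<noteq> j" "e = {i, j}"
    by (blast elim: nsets_2E)
  then obtain A B where AB: "A \<in> P" "i \<in> A" "B \<in> P" "j \<in> B"
    using partition_onD1[OF assms] by auto
  have "A \<noteq> B" using e AB ij by (auto simp: nsets_def)
  with AB ij e show "e \<in> cut V P" unfolding cut_def by blast
qed

text \<open>Once \<open>card E\<close> is positive, this makes modularity a strictly decreasing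
  affine function of the cut weight, with coefficients that are the same for all partitions.\<close>

lemma modularity_eq_cut_weight:
  assumes "simple_graph V E" "random_graph V \<G>" "partition_on V P"
  shows "modularity E \<G> P =
    1 / real (card E) * ((\<Sum>e\<in>nsets V 2. edge_weight E \<G> e) - cut_weight V E \<G> P)"
proof -
  have finV: "finite V" and E: "E \<subseteq> nsets V 2" using assms(1) by (auto simp: simple_graph_def)
  have finP: "finite P" using finV assms(3) by (rule finite_elements)
  have sub: "U \<subseteq> V" if "U \<in> P" for U using that partition_onD1[OF assms(3)] by auto
  have fin: "finite (nsets U 2)" if "U \<in> P" for U
    using sub[OF that] finV finite_subset finite_imp_finite_nsets by blast
  have summand: "real (card (edges_within E U)) - Ex U \<G> = (\<Sum>e\<in>nsets U 2. edge_weight E \<G> e)"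
    if "U \<in> P" for U
  proof -
    have "edges_within E U = nsets U 2 \<inter> E"
      using E by (auto simp: edges_within_def nsets_def)
    then have "real (card (edges_within E U)) = (\<Sum>e\<in>nsets U 2. of_bool (e \<in> E))"
      using fin[OF that] by (simp add: of_bool_def sum.If_cases Int_def)
    then show ?thesis
      using Ex_eq_sum_edge_prob[OF assms(2) finV sub[OF that]]
      by (simp add: edge_weight_nsets sum_subtractf)
  qed
  \<comment> \<open>A common pair would put a common vertex into two disjoint clusters; hence the
    double sum over clusters and pairs is one sum over the union.\<close>
  have disj: "nsets A 2 \<inter> nsets B 2 = {}" if "A \<in> P" "B \<in> P" "A \<noteq> B" for A B
  proof -
    have "A \<inter> B = {}" using partition_onD2[OF assms(3)] that by (auto simp: disjoint_def)
    moreover have "A \<inter> B \<noteq> {}" if e: "e \<in> nsets A 2" "e \<in> nsets B 2" for e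
      using e(1) by (rule nsets_2E) (use e(2) in \<open>auto simp: nsets_def\<close>)
    ultimately show ?thesis by blast
  qed
  have "(\<Sum>U\<in>P. real (card (edges_within E U)) - Ex U \<G>)
      = (\<Sum>e\<in>(\<Union>U\<in>P. nsets U 2). edge_weight E \<G> e)"
    using finP fin disj by (subst sum.UNION_disjoint) (auto simp: summand)
  also have "\<dots> = (\<Sum>e\<in>nsets V 2. edge_weight E \<G> e) - cut_weight V E \<G> P"
  proof -
    have "(\<Union>U\<in>P. nsets U 2) \<subseteq> nsets V 2" using sub by (auto simp: nsets_def)
    then show ?thesis
      using sum_diff[OF finite_imp_finite_nsets[OF finV], of "\<Union>U\<in>P. nsets U 2" 2 "edge_weight E \<G>"]
      by (simp add: cut_weight_def cut_partition[OF assms(3)])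
  qed
  finally show ?thesis by (simp add: modularity_def)
qed

lemma modularity_max_iff_cut_min:
  assumes "simple_graph V E" "card E \<ge> 1" "random_graph V \<G>"
  shows "is_arg_max (modularity E \<G>) (partition_on V) P \<longleftrightarrow>
    is_arg_min (cut_weight V E \<G>) (partition_on V) P"
proof -
  \<comment> \<open>Both \<open>is_arg_max\<close> and \<open>is_arg_min\<close> say that no
    strictly better partition exists, so reversing strict comparisons suffices. The factor
    \<open>1 / card E\<close> is positive since \<open>card E \<ge> 1\<close>.\<close>
  have "modularity E \<G> P < modularity E \<G> P' \<longleftrightarrow> cut_weight V E \<G> P' < cut_weight V E \<G> P"
    if "partition_on V P" "partition_on V P'" for P P'
    using that assms by (simp add: modularity_eq_cut_weight divide_simps)
  then show ?thesis unfolding is_arg_max_def is_arg_min_def by blast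
qed


section \<open>Frames and running times\<close>

text \<open>Natural and real arrays share one name set, matching \<open>overlay\<close>, which
  splits both memories by the same names. For programs, names read and names written are both
  collected.\<close>

primrec nvars :: "nexp \<Rightarrow> vname set" where
  "nvars (NConst k) = {}"
| "nvars (NAt x a) = insert x (nvars a)"
| "nvars (NAdd a b) = nvars a \<union> nvars b"
| "nvars (NSub a b) = nvars a \<union> nvars b"

primrec rvars :: "rexp \<Rightarrow> vname set" where
  "rvars (RConst r) = {}"
| "rvars (RAt x a) = insert x (nvars a)"
| "rvars (ROfNat a) = nvars a"
| "rvars (RAdd a b) = rvars a \<union> rvars b"
| "rvars (RSub a b) = rvars a \<union> rvars b"
| "rvars (RMul a b) = rvars a \<union> rvars b"
| "rvars (RDiv a b) = rvars a \<union> rvars b"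

primrec bvars :: "bexp \<Rightarrow> vname set" where
  "bvars (NLess a b) = nvars a \<union> nvars b"
| "bvars (RLess a b) = rvars a \<union> rvars b"
| "bvars (BNot b) = bvars b"
| "bvars (BAnd b c) = bvars b \<union> bvars c"

primrec vars :: "com \<Rightarrow> vname set" where
  "vars Skip = {}"
| "vars (NAssign x a b) = insert x (nvars a \<union> nvars b)"
| "vars (RAssign x a b) = insert x (nvars a \<union> rvars b)"
| "vars (Seq c d) = vars c \<union> vars d"
| "vars (If b c d) = bvars b \<union> vars c \<union> vars d"
| "vars (While b c) = bvars b \<union> vars c"

lemma finite_nvars: "finite (nvars a)"
  by (induction a) auto

lemma finite_rvars: "finite (rvars a)"
  by (induction a) (auto simp: finite_nvars)

lemma finite_bvars: "finite (bvars b)"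
  by (induction b) (auto simp: finite_nvars finite_rvars)

text \<open>Guarantees names that the programs of the model never mention.\<close>

lemma finite_vars: "finite (vars c)"
  by (induction c) (auto simp: finite_nvars finite_rvars finite_bvars)

section \<open>Memory updates and the frame rule\<close>

lemma nmem_nput [simp]: "nmem (nput x k v s) y l = (if y = x \<and> l = k then v else nmem s y l)"
  and rmem_nput [simp]: "rmem (nput x k v s) = rmem s"
  and nmem_rput [simp]: "nmem (rput x k r s) = nmem s"
  and rmem_rput [simp]: "rmem (rput x k r s) y l = (if y = x \<and> l = k then r else rmem s y l)"
  by (auto simp: nput_def rput_def)

lemma nput_rput: "nput x k v (rput y l r s) = rput y l r (nput x k v s)"
  by (simp add: nput_def rput_def)

lemma rput_rput [simp]: "rput x k r (rput x k r' s) = rput x k r s"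
  by (simp add: rput_def)

lemma rput_same: "rput x k (rmem s x k) s = s"
  by (simp add: rput_def)

text \<open>Separates the memory of the model's programs (\<open>s\<close>) from that of the
  construction (\<open>u\<close>), so that facts about the copied graph can be stated for
  \<open>u\<close> alone.\<close>

definition overlay :: "vname set \<Rightarrow> state \<Rightarrow> state \<Rightarrow> state" where
  "overlay A s u = \<lparr>nmem = (\<lambda>x. if x \<in> A then nmem s x else nmem u x),
     rmem = (\<lambda>x. if x \<in> A then rmem s x else rmem u x)\<rparr>"

lemma nmem_overlay [simp]: "nmem (overlay A s u) x = (if x \<in> A then nmem s x else nmem u x)"
  and rmem_overlay [simp]: "rmem (overlay A s u) x = (if x \<in> A then rmem s x else rmem u x)"
  by (auto simp: overlay_def)

lemma overlay_same [simp]: "overlay A s s = s"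
  by (simp add: overlay_def)

lemma nput_overlay [simp]: "nput x k v (overlay A s u) =
    (if x \<in> A then overlay A (nput x k v s) u else overlay A s (nput x k v u))"
  by (auto simp: overlay_def nput_def)

lemma rput_overlay [simp]: "rput x k v (overlay A s u) =
    (if x \<in> A then overlay A (rput x k v s) u else overlay A s (rput x k v u))"
  by (auto simp: overlay_def rput_def)

lemma nval_overlay: "nvars a \<subseteq> A \<Longrightarrow> nval a (overlay A s u) = nval a s"
  by (induction a) auto

lemma rval_overlay: "rvars a \<subseteq> A \<Longrightarrow> rval a (overlay A s u) = rval a s"
  by (induction a) (auto simp: nval_overlay)

lemma bval_overlay: "bvars b \<subseteq> A \<Longrightarrow> bval b (overlay A s u) = bval b s"
  by (induction b) (auto simp: nval_overlay rval_overlay)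

text \<open>Frame rule: all reads and writes fall in \<open>A\<close>, so values and branches are
  those of the original run and writes act on the first component. The step count is the same
  because costs depend on syntax only.\<close>

lemma exec_overlay:
  assumes "exec c s t s'" "vars c \<subseteq> A"
  shows "exec c (overlay A s u) t (overlay A s' u)"
  using assms
proof (induction rule: exec.induct)
  case (NAssign x a b s)
  then show ?case using exec.NAssign[of x a b "overlay A s u"] by (simp add: nval_overlay)
next
  case (RAssign x a b s)
  then show ?case
    using exec.RAssign[of x a b "overlay A s u"] by (simp add: nval_overlay rval_overlay)
qed ((rule exec.intros; simp add: bval_overlay)+)

text \<open>An upper bound replaces the exact step count because \<open>pre\<close> and
  \<open>q\<close> are only known to halt within a bound.\<close>

definition exec_within :: "com \<Rightarrow> state \<Rightarrow> nat \<Rightarrow> state \<Rightarrow> bool" where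
  "exec_within c s T s' \<longleftrightarrow> (\<exists>t\<le>T. exec c s t s')"

lemma exec_within_mono: "exec_within c s T s' \<Longrightarrow> T \<le> T' \<Longrightarrow> exec_within c s T' s'"
  unfolding exec_within_def by (meson le_trans)

lemma exec_within_overlay:
  "exec_within c s T s' \<Longrightarrow> vars c \<subseteq> A \<Longrightarrow> exec_within c (overlay A s u) T (overlay A s' u)"
  unfolding exec_within_def by (meson exec_overlay)

lemma exec_within_Seq:
  "exec_within c s T s' \<Longrightarrow> exec_within d s' U s'' \<Longrightarrow> exec_within (Seq c d) s (T + U) s''"
  unfolding exec_within_def by (meson exec.Seq add_mono)

lemma exec_within_NAssign:
  assumes "T = 1 + ncost a + ncost b" "s' = nput x (nval a s) (nval b s) s"
  shows "exec_within (NAssign x a b) s T s'"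
  unfolding exec_within_def assms by (meson exec.NAssign order_refl)

lemma exec_within_RAssign:
  assumes "T = 1 + ncost a + rcost b" "s' = rput x (nval a s) (rval b s) s"
  shows "exec_within (RAssign x a b) s T s'"
  unfolding exec_within_def assms by (meson exec.RAssign order_refl)

text \<open>Rule for loops with exactly \<open>n\<close> iterations, where \<open>I k\<close>
  describes the state after \<open>k\<close> of them. The bound pays for \<open>n\<close> successful
  tests with their bodies and one failing test.\<close>

lemma exec_within_While:
  assumes step: "\<And>k s. k < n \<Longrightarrow> I k s \<Longrightarrow> \<exists>s'. exec_within c s T s' \<and> I (Suc k) s'"
    and guard: "\<And>k s. k \<le> n \<Longrightarrow> I k s \<Longrightarrow> bval b s \<longleftrightarrow> k < n"
    and init: "I 0 s"
    and time: "U = n * (1 + bcost b + T) + (1 + bcost b)"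
  shows "\<exists>s'. exec_within (While b c) s U s' \<and> I n s'"
proof -
  \<comment> \<open>Generalised to a start after \<open>k\<close> iterations with a budget for the
    remaining \<open>n - k\<close>; the induction descends from \<open>n\<close>, where only the
    failing test is left.\<close>
  have "\<exists>s'. exec_within (While b c) s ((n - k) * (1 + bcost b + T) + (1 + bcost b)) s' \<and> I n s'"
    if "k \<le> n" "I k s" for k s
    using that
  proof (induction k arbitrary: s rule: inc_induct)
    case base
    then have "exec_within (While b c) s (1 + bcost b) s"
      using guard[of n s] exec.WhileFalse[of b s c] by (auto simp: exec_within_def)
    with base show ?case by auto
  next
    case (step k)
    obtain s' where s': "exec_within c s T s'" "I (Suc k) s'"
      using assms(1)[OF _ step.prems] step.hyps by blast
    obtain s'' where
      s'': "exec_within (While b c) s' ((n - Suc k) * (1 + bcost b + T) + (1 + bcost b)) s''" "I n s''"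
      using step.IH[OF s'(2)] by blast
    obtain t u where tu: "t \<le> T" "exec c s t s'"
      "u \<le> (n - Suc k) * (1 + bcost b + T) + (1 + bcost b)" "exec (While b c) s' u s''"
      using s'(1) s''(1) by (auto simp: exec_within_def)
    have "bval b s" using guard[OF _ step.prems] step.hyps by simp
    then have "exec (While b c) s (1 + bcost b + t + u) s''"
      using tu exec.WhileTrue by blast
    moreover have "n - k = Suc (n - Suc k)" using step.hyps by simp
    then have "(n - k) * (1 + bcost b + T) = 1 + bcost b + T + (n - Suc k) * (1 + bcost b + T)"
      by simp
    then have "1 + bcost b + t + u \<le> (n - k) * (1 + bcost b + T) + (1 + bcost b)"
      using tu by linarith
    ultimately show ?case using s''(2) unfolding exec_within_def by blast
  qed
  from this[of 0 s] init time show ?thesis by simp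
qed


section \<open>Construction of the weighted graph\<close>

lemma edge_list_length:
  assumes "edge_list \<nu> V E es"
  shows "length es = card E"
  using assms distinct_card unfolding edge_list_def by fastforce

lemma edge_list_nth:
  assumes "edge_list \<nu> V E es" "k < length es"
  shows "fst (es ! k) < card V" "snd (es ! k) < card V" "{\<nu> (fst (es ! k)), \<nu> (snd (es ! k))} \<in> E"
proof -
  have "es ! k \<in> set es" using assms(2) by simp
  then show "fst (es ! k) < card V" "snd (es ! k) < card V"
    "{\<nu> (fst (es ! k)), \<nu> (snd (es ! k))} \<in> E"
    using assms(1) unfolding edge_list_def by (force simp: case_prod_beta)+
qed

text \<open>
  The programs \<open>pre\<close> and \<open>q\<close> of the model may overwrite the input and may use \<open>''out''\<close> as
  memory between queries. Hence the graph is kept in variables outside \<open>A\<close>, which they do not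
  touch, and the last value of \<open>''out''\<close> is kept in \<open>xo\<close>.
\<close>

locale construction =
  fixes A :: "vname set" and pre q :: com and xn xm xs xd xk xw xo :: vname
  assumes vars_pre: "vars pre \<subseteq> A" and vars_q: "vars q \<subseteq> A"
    and io_vars: "{''n'', ''m'', ''src'', ''dst'', ''i'', ''j'', ''out''} \<subseteq> A"
    and fresh: "A \<inter> {xn, xm, xs, xd, xk, xw, xo} = {}"
    and distinct: "distinct [xn, xm, xs, xd, xk, xw, xo]"
begin

section \<open>The programs and their invariants\<close>

abbreviation "nscalar x \<equiv> NAt x (NConst 0)"
abbreviation "rscalar x \<equiv> RAt x (NConst 0)"
abbreviation "increment \<equiv> NAssign xk (NConst 0) (NAdd (nscalar xk) (NConst 1))"
abbreviation "guard \<equiv> NLess (nscalar xk) (nscalar xm)"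

definition copy_step :: com where
  "copy_step = Seq (NAssign xs (nscalar xk) (NAt ''src'' (nscalar xk)))
    (Seq (NAssign xd (nscalar xk) (NAt ''dst'' (nscalar xk))) increment)"

definition copy_init :: com where
  "copy_init = Seq (NAssign xn (NConst 0) (nscalar ''n''))
    (Seq (NAssign xm (NConst 0) (nscalar ''m'')) (NAssign xk (NConst 0) (NConst 0)))"

text \<open>\<open>j\<close> is written before \<open>i\<close> so that \<open>q\<close> starts in
  literally the state that \<open>answers\<close> prescribes.\<close>

definition weight_step :: com where
  "weight_step = Seq (NAssign ''j'' (NConst 0) (NAt xd (nscalar xk)))
    (Seq (NAssign ''i'' (NConst 0) (NAt xs (nscalar xk)))
    (Seq q
    (Seq (RAssign xw (nscalar xk) (RSub (RConst 1) (rscalar ''out''))) increment)))"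

text \<open>The last assignment creates the backup of \<open>out\<close> that the first later query
  restores.\<close>

definition build :: com where
  "build = Seq copy_init (Seq (While guard copy_step)
    (Seq pre (Seq (NAssign xk (NConst 0) (NConst 0)) (Seq (While guard weight_step)
    (RAssign xo (NConst 0) (rscalar ''out''))))))"

text \<open>The negated result overwrites what \<open>q\<close> left in \<open>out\<close>. The
  backup is therefore refreshed before the negation and written back before the next run of
  \<open>q\<close>.\<close>

definition weight_query :: com where
  "weight_query = Seq (RAssign ''out'' (NConst 0) (rscalar xo))
    (Seq q
    (Seq (RAssign xo (NConst 0) (rscalar ''out''))
      (RAssign ''out'' (NConst 0) (RSub (RConst 0) (rscalar ''out'')))))"

lemma io_in [simp]: "''n'' \<in> A" "''m'' \<in> A" "''src'' \<in> A" "''dst'' \<in> A" "''i'' \<in> A" "''j'' \<in> A"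
  "''out'' \<in> A"
  using io_vars by auto

lemma fresh_notin [simp]: "xn \<notin> A" "xm \<notin> A" "xs \<notin> A" "xd \<notin> A" "xk \<notin> A" "xw \<notin> A" "xo \<notin> A"
  using fresh by auto

lemma fresh_neq [simp]:
  "xn \<noteq> xm" "xn \<noteq> xs" "xn \<noteq> xd" "xn \<noteq> xk" "xm \<noteq> xs" "xm \<noteq> xd" "xm \<noteq> xk" "xs \<noteq> xd" "xs \<noteq> xk" "xd \<noteq> xk"
  "xm \<noteq> xn" "xs \<noteq> xn" "xd \<noteq> xn" "xk \<noteq> xn" "xs \<noteq> xm" "xd \<noteq> xm" "xk \<noteq> xm" "xd \<noteq> xs" "xk \<noteq> xs" "xk \<noteq> xd"
  "xw \<noteq> xo" "xo \<noteq> xw"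
  using distinct by auto

text \<open>\<open>k\<close> is the length of the copied prefix: this is the invariant of the
  copying loop and, at \<open>length es\<close>, the fact carried through all later phases.\<close>

definition edges_stored :: "nat \<Rightarrow> nat \<Rightarrow> (nat \<times> nat) list \<Rightarrow> state \<Rightarrow> bool" where
  "edges_stored n k es u \<longleftrightarrow> nmem u xn 0 = n \<and> nmem u xm 0 = length es \<and>
     (\<forall>l<k. nmem u xs l = fst (es ! l) \<and> nmem u xd l = snd (es ! l))"

definition weights_stored ::
  "(nat \<Rightarrow> nat \<Rightarrow> real) \<Rightarrow> nat \<Rightarrow> (nat \<times> nat) list \<Rightarrow> state \<Rightarrow> bool" where
  "weights_stored f k es u \<longleftrightarrow> (\<forall>l<k. rmem u xw l = 1 - f (fst (es ! l)) (snd (es ! l)))"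

section \<open>Copying the edge list\<close>

lemma exec_copy_init:
  obtains u where "exec_within copy_init (input_state n es) 11 (overlay A (input_state n es) u)"
    "edges_stored n 0 es u" "nmem u xk 0 = 0"
proof -
  let ?s = "input_state n es"
  let ?u = "nput xk 0 0 (nput xm 0 (length es) (nput xn 0 n ?s))"
  have vals: "nmem ?s ''n'' 0 = n" "nmem ?s ''m'' 0 = length es"
    by (auto simp: input_state_def)
  \<comment> \<open>The input state is read as an overlay of itself, so that the first write to a
    fresh name goes to the second component.\<close>
  have n: "exec_within (NAssign xn (NConst 0) (nscalar ''n'')) (overlay A ?s ?s) 4
      (overlay A ?s (nput xn 0 n ?s))"
    by (rule exec_within_NAssign) (simp_all add: vals del: overlay_same)
  have m: "exec_within (NAssign xm (NConst 0) (nscalar ''m'')) (overlay A ?s (nput xn 0 n ?s)) 4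
      (overlay A ?s (nput xm 0 (length es) (nput xn 0 n ?s)))"
    by (rule exec_within_NAssign) (simp_all add: vals)
  have k: "exec_within (NAssign xk (NConst 0) (NConst 0))
      (overlay A ?s (nput xm 0 (length es) (nput xn 0 n ?s))) 3 (overlay A ?s ?u)"
    by (rule exec_within_NAssign) simp_all
  have "exec_within copy_init ?s 11 (overlay A ?s ?u)"
    unfolding copy_init_def
    using exec_within_mono[OF exec_within_Seq[OF n exec_within_Seq[OF m k]]] by simp
  moreover have "edges_stored n 0 es ?u" "nmem ?u xk 0 = 0"
    by (auto simp: edges_stored_def)
  ultimately show ?thesis using that by simp
qed

lemma exec_copy_step:
  assumes "edges_stored n k es u" "nmem u xk 0 = k" "k < length es"
  obtains u' where "exec_within copy_step (overlay A (input_state n es) u) 18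
      (overlay A (input_state n es) u')"
    "edges_stored n (Suc k) es u'" "nmem u' xk 0 = Suc k"
proof -
  let ?s = "input_state n es"
  let ?u = "nput xk 0 (Suc k) (nput xd k (snd (es ! k)) (nput xs k (fst (es ! k)) u))"
  have src: "nmem ?s ''src'' k = fst (es ! k)" and dst: "nmem ?s ''dst'' k = snd (es ! k)"
    using assms(3) by (auto simp: input_state_def)
  have x: "exec_within (NAssign xs (nscalar xk) (NAt ''src'' (nscalar xk))) (overlay A ?s u) 6
      (overlay A ?s (nput xs k (fst (es ! k)) u))"
    by (rule exec_within_NAssign) (simp_all add: assms(2) src)
  have y: "exec_within (NAssign xd (nscalar xk) (NAt ''dst'' (nscalar xk)))
      (overlay A ?s (nput xs k (fst (es ! k)) u)) 6
      (overlay A ?s (nput xd k (snd (es ! k)) (nput xs k (fst (es ! k)) u)))"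
    by (rule exec_within_NAssign) (simp_all add: assms(2) dst)
  have k: "exec_within increment
      (overlay A ?s (nput xd k (snd (es ! k)) (nput xs k (fst (es ! k)) u))) 6 (overlay A ?s ?u)"
    by (rule exec_within_NAssign) (simp_all add: assms(2))
  have "exec_within copy_step (overlay A ?s u) 18 (overlay A ?s ?u)"
    unfolding copy_step_def
    by (rule exec_within_mono[OF exec_within_Seq[OF x exec_within_Seq[OF y k]]]) simp
  moreover have "edges_stored n (Suc k) es ?u" "nmem ?u xk 0 = Suc k"
    using assms by (auto simp: edges_stored_def less_Suc_eq)
  ultimately show ?thesis using that by blast
qed

text \<open>Each iteration costs 18 steps for the body and 6 for the test; the final 6 is the
  failing test.\<close>

lemma exec_copy:
  assumes "edges_stored n 0 es u" "nmem u xk 0 = 0"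
  obtains u' where "exec_within (While guard copy_step) (overlay A (input_state n es) u)
      (length es * 24 + 6) (overlay A (input_state n es) u')"
    "edges_stored n (length es) es u'"
proof -
  let ?I = "\<lambda>k s. \<exists>u. s = overlay A (input_state n es) u \<and> edges_stored n k es u \<and> nmem u xk 0 = k"
  have "\<exists>s'. exec_within (While guard copy_step) (overlay A (input_state n es) u)
      (length es * 24 + 6) s' \<and> ?I (length es) s'"
  proof (rule exec_within_While[where I = ?I])
    fix k s assume "k < length es" "?I k s"
    then show "\<exists>s'. exec_within copy_step s 18 s' \<and> ?I (Suc k) s'"
      by (metis exec_copy_step)
  next
    fix k s assume "?I k s"
    then show "bval guard s \<longleftrightarrow> k < length es" by (auto simp: edges_stored_def)
  next
    show "?I 0 (overlay A (input_state n es) u)" using assms by blast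
  qed simp
  then show ?thesis using that by blast
qed

text \<open>One unfolding of the coinductive \<open>answers\<close>. By the frame rule the model's
  run ignores the surrounding memory, so \<open>v'\<close> can be fixed before \<open>u\<close> is
  chosen.\<close>

lemma exec_query:
  assumes "answers q d D f (\<lambda>_. True) v" "(i, j) \<in> D"
  obtains v' where
    "\<And>u. exec_within q (overlay A (nput ''i'' 0 i (nput ''j'' 0 j v)) u) d (overlay A v' u)"
    "rmem v' ''out'' 0 = f i j" "answers q d D f (\<lambda>_. True) v'"
proof -
  have "\<exists>t v'. exec q (nput ''i'' 0 i (nput ''j'' 0 j v)) t v' \<and> t \<le> d \<and>
      rmem v' ''out'' 0 = f i j \<and> answers q d D f (\<lambda>_. True) v'"
    using assms(1) by (rule answers.cases) (use assms(2) in simp)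
  then obtain t v' where "exec q (nput ''i'' 0 i (nput ''j'' 0 j v)) t v'" "t \<le> d"
    "rmem v' ''out'' 0 = f i j" "answers q d D f (\<lambda>_. True) v'" by blast
  then show ?thesis
    using that exec_within_overlay[OF _ vars_q] unfolding exec_within_def by blast
qed

section \<open>Computing the weights of the listed edges\<close>

lemma exec_weight_step:
  assumes "answers q d D f (\<lambda>_. True) v" "es ! k \<in> D" "k < length es"
    and "edges_stored n (length es) es u" "weights_stored f k es u" "nmem u xk 0 = k"
  obtains v' u' where "exec_within weight_step (overlay A v u) (d + 23) (overlay A v' u')"
    "answers q d D f (\<lambda>_. True) v'"
    "edges_stored n (length es) es u'" "weights_stored f (Suc k) es u'" "nmem u' xk 0 = Suc k"
proof -
  let ?i = "fst (es ! k)" and ?j = "snd (es ! k)"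
  have mem: "nmem u xs k = ?i" "nmem u xd k = ?j"
    using assms(3,4) by (auto simp: edges_stored_def)
  have "(?i, ?j) \<in> D" using assms(2) by simp
  from exec_query[OF assms(1) this] obtain v' where v':
    "\<And>u. exec_within q (overlay A (nput ''i'' 0 ?i (nput ''j'' 0 ?j v)) u) d (overlay A v' u)"
    "rmem v' ''out'' 0 = f ?i ?j" "answers q d D f (\<lambda>_. True) v'" by blast
  let ?u = "nput xk 0 (Suc k) (rput xw k (1 - f ?i ?j) u)"
  have j: "exec_within (NAssign ''j'' (NConst 0) (NAt xd (nscalar xk))) (overlay A v u) 5
      (overlay A (nput ''j'' 0 ?j v) u)"
    by (rule exec_within_NAssign) (simp_all add: assms(6) mem)
  have i: "exec_within (NAssign ''i'' (NConst 0) (NAt xs (nscalar xk)))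
      (overlay A (nput ''j'' 0 ?j v) u) 5 (overlay A (nput ''i'' 0 ?i (nput ''j'' 0 ?j v)) u)"
    by (rule exec_within_NAssign) (simp_all add: assms(6) mem)
  have w: "exec_within (RAssign xw (nscalar xk) (RSub (RConst 1) (rscalar ''out'')))
      (overlay A v' u) 7 (overlay A v' (rput xw k (1 - f ?i ?j) u))"
    by (rule exec_within_RAssign) (simp_all add: assms(6) v'(2))
  have k: "exec_within increment (overlay A v' (rput xw k (1 - f ?i ?j) u)) 6 (overlay A v' ?u)"
    by (rule exec_within_NAssign) (simp_all add: assms(6))
  have "exec_within weight_step (overlay A v u) (d + 23) (overlay A v' ?u)"
    unfolding weight_step_def
    using exec_within_Seq[OF j exec_within_Seq[OF i exec_within_Seq[OF v'(1) exec_within_Seq[OF w k]]]]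
    by (simp add: add.commute)
  moreover have "edges_stored n (length es) es ?u" "weights_stored f (Suc k) es ?u" "nmem ?u xk 0 = Suc k"
    using assms(4,5) by (auto simp: edges_stored_def weights_stored_def less_Suc_eq)
  ultimately show ?thesis using that v'(3) by blast
qed

lemma exec_weights:
  assumes "answers q d D f (\<lambda>_. True) v" "set es \<subseteq> D"
    and "edges_stored n (length es) es u" "nmem u xk 0 = 0"
  obtains v' u' where "exec_within (While guard weight_step) (overlay A v u)
      (length es * (d + 29) + 6) (overlay A v' u')"
    "answers q d D f (\<lambda>_. True) v'"
    "edges_stored n (length es) es u'" "weights_stored f (length es) es u'"
proof -
  \<comment> \<open>Each query may change the model's memory, so the invariant asks only for some
    \<open>v\<close> that can still answer all further queries.\<close>
  let ?I = "\<lambda>k s. \<exists>v u. s = overlay A v u \<and> answers q d D f (\<lambda>_. True) v \<and>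
    edges_stored n (length es) es u \<and> weights_stored f k es u \<and> nmem u xk 0 = k"
  have "\<exists>s'. exec_within (While guard weight_step) (overlay A v u)
      (length es * (d + 29) + 6) s' \<and> ?I (length es) s'"
  proof (rule exec_within_While[where I = ?I])
    fix k s assume k: "k < length es" and "?I k s"
    then obtain v u where *: "s = overlay A v u" "answers q d D f (\<lambda>_. True) v"
      "edges_stored n (length es) es u" "weights_stored f k es u" "nmem u xk 0 = k" by blast
    have "es ! k \<in> D" using k assms(2) by auto
    from exec_weight_step[OF *(2) this k *(3-5)]
    show "\<exists>s'. exec_within weight_step s (d + 23) s' \<and> ?I (Suc k) s'"
      unfolding *(1) by metis
  next
    fix k s assume "?I k s"
    then show "bval guard s \<longleftrightarrow> k < length es" by (auto simp: edges_stored_def)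
  next
    show "?I 0 (overlay A v u)"
      using assms by (auto simp: weights_stored_def)
  qed simp
  then show ?thesis using that by blast
qed

text \<open>Per edge, copying costs 24 and the weight loop \<open>d + 29\<close>; the 30 collects
  initialisation, the two failing tests, the counter reset and the backup.\<close>

lemma exec_build:
  assumes "exec_within pre (input_state n es) T s0" "answers q d D f (\<lambda>_. True) s0" "set es \<subseteq> D"
  obtains v u where
    "exec_within build (input_state n es) (T + length es * (d + 53) + 30) (overlay A v u)"
    "answers q d D f (\<lambda>_. True) v" "rmem u xo 0 = rmem v ''out'' 0"
    "edges_stored n (length es) es u" "weights_stored f (length es) es u"
proof -
  let ?s = "input_state n es"
  obtain u1 where u1: "exec_within copy_init ?s 11 (overlay A ?s u1)"
    "edges_stored n 0 es u1" "nmem u1 xk 0 = 0" by (rule exec_copy_init)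
  obtain u2 where u2: "exec_within (While guard copy_step) (overlay A ?s u1) (length es * 24 + 6)
      (overlay A ?s u2)" "edges_stored n (length es) es u2"
    by (rule exec_copy[OF u1(2,3)])
  \<comment> \<open>Copying has left the first component equal to the input state, so the assumed
    run of \<open>pre\<close> can be framed.\<close>
  have pre: "exec_within pre (overlay A ?s u2) T (overlay A s0 u2)"
    by (rule exec_within_overlay[OF assms(1) vars_pre])
  let ?u3 = "nput xk 0 0 u2"
  have reset: "exec_within (NAssign xk (NConst 0) (NConst 0)) (overlay A s0 u2) 3 (overlay A s0 ?u3)"
    by (rule exec_within_NAssign) simp_all
  have "edges_stored n (length es) es ?u3" "nmem ?u3 xk 0 = 0"
    using u2(2) by (auto simp: edges_stored_def)
  from exec_weights[OF assms(2,3) this] obtain v u4 where u4: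
    "exec_within (While guard weight_step) (overlay A s0 ?u3) (length es * (d + 29) + 6) (overlay A v u4)"
    "answers q d D f (\<lambda>_. True) v"
    "edges_stored n (length es) es u4" "weights_stored f (length es) es u4" by blast
  let ?u5 = "rput xo 0 (rmem v ''out'' 0) u4"
  have save: "exec_within (RAssign xo (NConst 0) (rscalar ''out'')) (overlay A v u4) 4 (overlay A v ?u5)"
    by (rule exec_within_RAssign) simp_all
  have "exec_within build ?s (T + length es * (d + 53) + 30) (overlay A v ?u5)"
    unfolding build_def
    by (rule exec_within_mono[OF exec_within_Seq[OF u1(1) exec_within_Seq[OF u2(1)
          exec_within_Seq[OF pre exec_within_Seq[OF reset exec_within_Seq[OF u4(1) save]]]]]])
      (simp add: algebra_simps)
  moreover have "edges_stored n (length es) es ?u5" "weights_stored f (length es) es ?u5"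
    using u4(3,4) by (auto simp: edges_stored_def weights_stored_def)
  ultimately show ?thesis using that[of v ?u5] u4(2) by simp
qed

text \<open>The state \<open>v\<close> is where \<open>q\<close> would resume. The actual memory has
  an arbitrary \<open>r\<close> in \<open>out\<close> instead, such as an earlier negated answer,
  and the backup in \<open>xo\<close> repairs it.\<close>

lemma exec_weight_query:
  assumes "answers q d D f (\<lambda>_. True) v" "(i, j) \<in> D" "rmem u xo 0 = rmem v ''out'' 0"
  obtains v' where
    "exec_within weight_query (nput ''i'' 0 i (nput ''j'' 0 j (overlay A (rput ''out'' 0 r v) u))) (d + 14)
      (overlay A (rput ''out'' 0 (- f i j) v') (rput xo 0 (rmem v' ''out'' 0) u))"
    "answers q d D f (\<lambda>_. True) v'"
proof -
  let ?v = "nput ''i'' 0 i (nput ''j'' 0 j v)"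
  let ?s = "nput ''i'' 0 i (nput ''j'' 0 j (overlay A (rput ''out'' 0 r v) u))"
  from exec_query[OF assms(1,2)] obtain v' where v': "\<And>u. exec_within q (overlay A ?v u) d (overlay A v' u)"
    "rmem v' ''out'' 0 = f i j" "answers q d D f (\<lambda>_. True) v'" by blast
  let ?u = "rput xo 0 (rmem v' ''out'' 0) u"
  \<comment> \<open>Restoring \<open>out\<close> replaces \<open>r\<close> by its value in
    \<open>v\<close>; writing the query indices affects the other memory and commutes with
    this.\<close>
  have same: "rput ''out'' 0 (rmem v ''out'' 0) ?v = ?v"
    using rput_same[of "''out''" 0 ?v] by simp
  have restore: "exec_within (RAssign ''out'' (NConst 0) (rscalar xo)) ?s 4 (overlay A ?v u)"
    by (rule exec_within_RAssign) (simp_all add: nput_rput same assms(3))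
  have save: "exec_within (RAssign xo (NConst 0) (rscalar ''out'')) (overlay A v' u) 4 (overlay A v' ?u)"
    by (rule exec_within_RAssign) simp_all
  have negate: "exec_within (RAssign ''out'' (NConst 0) (RSub (RConst 0) (rscalar ''out'')))
      (overlay A v' ?u) 6 (overlay A (rput ''out'' 0 (- f i j) v') ?u)"
    by (rule exec_within_RAssign) (simp_all add: v'(2))
  have "exec_within weight_query ?s (d + 14) (overlay A (rput ''out'' 0 (- f i j) v') ?u)"
    unfolding weight_query_def
    using exec_within_Seq[OF restore exec_within_Seq[OF v'(1) exec_within_Seq[OF save negate]]]
    by (simp add: add.commute)
  then show ?thesis using that v'(3) by blast
qed

text \<open>By coinduction: every query leads back to a state of the same shape, and that shape
  implies \<open>R\<close>.\<close>

lemma answers_weight_query: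
  assumes "answers q d D f (\<lambda>_. True) v" "rmem u xo 0 = rmem v ''out'' 0"
    and "edges_stored n k es u" "weights_stored f k es u"
    and D': "D' \<subseteq> D" "\<And>i j. (i, j) \<in> D' \<Longrightarrow> g i j = - f i j"
    and R: "\<And>v u. edges_stored n k es u \<Longrightarrow> weights_stored f k es u \<Longrightarrow> R (overlay A v u)"
  shows "answers weight_query (d + 14) D' g R (overlay A v u)"
proof -
  \<comment> \<open>The coinduction invariant: \<open>v\<close> is the intact state of the model,
    \<open>r\<close> the value now in \<open>out\<close>, and \<open>xo\<close> holds the value
    \<open>q\<close> expects there.\<close>
  define K where "K s \<longleftrightarrow> (\<exists>v u r. s = overlay A (rput ''out'' 0 r v) u \<and>
    answers q d D f (\<lambda>_. True) v \<and> rmem u xo 0 = rmem v ''out'' 0 \<and>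
    edges_stored n k es u \<and> weights_stored f k es u)" for s
  have step: "\<exists>t s'. exec weight_query (nput ''i'' 0 i (nput ''j'' 0 j s)) t s' \<and> t \<le> d + 14 \<and>
      rmem s' ''out'' 0 = g i j \<and> K s'" if "K s" and ij: "(i, j) \<in> D'" for s i j
  proof -
    from \<open>K s\<close> obtain v u r where s: "s = overlay A (rput ''out'' 0 r v) u"
      "answers q d D f (\<lambda>_. True) v" "rmem u xo 0 = rmem v ''out'' 0"
      "edges_stored n k es u" "weights_stored f k es u" unfolding K_def by blast
    have "(i, j) \<in> D" using ij D'(1) by blast
    from exec_weight_query[OF s(2) this s(3), of r] obtain v' where v':
      "exec_within weight_query (nput ''i'' 0 i (nput ''j'' 0 j s)) (d + 14)
        (overlay A (rput ''out'' 0 (- f i j) v') (rput xo 0 (rmem v' ''out'' 0) u))"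
      "answers q d D f (\<lambda>_. True) v'" unfolding s(1) by blast
    let ?u = "rput xo 0 (rmem v' ''out'' 0) u"
    let ?s' = "overlay A (rput ''out'' 0 (- f i j) v') ?u"
    have "rmem ?s' ''out'' 0 = g i j" using D'(2)[OF ij] by simp
    moreover have "edges_stored n k es ?u" "weights_stored f k es ?u"
      using s(4,5) by (auto simp: edges_stored_def weights_stored_def)
    moreover have "rmem ?u xo 0 = rmem v' ''out'' 0" by simp
    ultimately have "rmem ?s' ''out'' 0 = g i j" "K ?s'"
      using v'(2) unfolding K_def by blast+
    with v'(1) show ?thesis unfolding exec_within_def by blast
  qed
  have inv: "R s" if "K s" for s
    using that R unfolding K_def by blast
  \<comment> \<open>Before the first query \<open>out\<close> is unspoiled, so \<open>r\<close> is
    its current value.\<close>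
  have "K (overlay A v u)"
    unfolding K_def using assms(1-4) rput_same[of "''out''" 0 v] by metis
  then show ?thesis
  proof (rule answers.coinduct)
    fix s assume "K s"
    then show "\<exists>s'. s = s' \<and> R s' \<and> (\<forall>i j. (i, j) \<in> D' \<longrightarrow>
        (\<exists>t s''. exec weight_query (nput ''i'' 0 i (nput ''j'' 0 j s')) t s'' \<and> t \<le> d + 14 \<and>
          rmem s'' ''out'' 0 = g i j \<and> (K s'' \<or> answers weight_query (d + 14) D' g R s'')))"
      using step[of s] inv[of s] by meson
  qed
qed

text \<open>Every listed pair is an edge, so one minus its probability is the first case of
  \<open>weight\<close>; the witness is the input list itself.\<close>

lemma stores_weighted_edges_overlay:
  assumes "edge_list \<nu> V E es" "edges_stored (card V) (length es) es u"
    and "weights_stored (\<lambda>i j. edge_prob \<G> (\<nu> i) (\<nu> j)) (length es) es u"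
  shows "stores_weighted_edges xn xm xs xd xw \<nu> V E (weight E \<G>) (overlay A v u)"
  unfolding stores_weighted_edges_def
  using assms edge_list_length[OF assms(1)] edge_list_nth(3)[OF assms(1)]
  by (auto simp: edges_stored_def weights_stored_def weight_def intro!: exI[of _ es])

section \<open>Linear time bound and uniform choice of programs\<close>

lemma build_weighted_graph:
  assumes "simple_graph V E" "card E \<ge> 1" "edge_list \<nu> V E es"
    and "exec_within pre (input_state (card V) es) (c * (card V + card E)) s0"
    and "answers q d {(i, j). i < card V \<and> j < card V \<and> i \<noteq> j}
      (\<lambda>i j. edge_prob \<G> (\<nu> i) (\<nu> j)) (\<lambda>_. True) s0"
  shows "\<exists>t s. exec build (input_state (card V) es) t s \<and> t \<le> (c + d + 85) * (card V + card E) \<and>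
    answers weight_query (d + 14) {(i, j). i < card V \<and> j < card V \<and> {\<nu> i, \<nu> j} \<in> nsets V 2 - E}
      (\<lambda>i j. weight E \<G> (\<nu> i) (\<nu> j))
      (stores_weighted_edges xn xm xs xd xw \<nu> V E (weight E \<G>)) s"
proof -
  let ?D = "{(i, j). i < card V \<and> j < card V \<and> i \<noteq> j}"
  let ?f = "\<lambda>i j. edge_prob \<G> (\<nu> i) (\<nu> j)"
  have E: "E \<subseteq> nsets V 2" using assms(1) by (auto simp: simple_graph_def)
  have loopless: "i \<noteq> j" if "{\<nu> i, \<nu> j} \<in> nsets V 2" for i j
    using that by (auto simp: nsets_def)
  \<comment> \<open>The model answers only for distinct indices; equal ones would give a singleton,
    which is no edge.\<close>
  have "set es \<subseteq> ?D"
  proof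
    fix x assume "x \<in> set es"
    then obtain k where "k < length es" "x = es ! k" by (auto simp: in_set_conv_nth)
    then have "fst x < card V" "snd x < card V" "fst x \<noteq> snd x"
      using edge_list_nth[OF assms(3), of k] loopless E by blast+
    then show "x \<in> ?D" by (simp add: case_prod_beta)
  qed
  from exec_build[OF assms(4,5) this] obtain v u where vu:
    "exec_within build (input_state (card V) es)
      (c * (card V + card E) + length es * (d + 53) + 30) (overlay A v u)"
    "answers q d ?D ?f (\<lambda>_. True) v" "rmem u xo 0 = rmem v ''out'' 0"
    "edges_stored (card V) (length es) es u" "weights_stored ?f (length es) es u" by blast
  \<comment> \<open>On pairs outside \<open>E\<close> the weight is the negated edge probability,
    and such pairs have distinct indices, so they are legitimate model queries.\<close>
  have "answers weight_query (d + 14)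
      {(i, j). i < card V \<and> j < card V \<and> {\<nu> i, \<nu> j} \<in> nsets V 2 - E}
      (\<lambda>i j. weight E \<G> (\<nu> i) (\<nu> j))
      (stores_weighted_edges xn xm xs xd xw \<nu> V E (weight E \<G>)) (overlay A v u)"
    by (rule answers_weight_query[OF vu(2-5)])
      (auto simp: weight_def intro!: stores_weighted_edges_overlay assms(3) dest: loopless)
  moreover have "c * (card V + card E) + length es * (d + 53) + 30 \<le> (c + d + 85) * (card V + card E)"
  proof -
    \<comment> \<open>As \<open>card E\<close> is at least 1, the constant 30 is absorbed into the
      cost per edge, with 2 to spare.\<close>
    have "length es * (d + 53) + 30 \<le> card E * (d + 85)"
      using assms(2) edge_list_length[OF assms(3)] by (simp add: algebra_simps)
    also have "\<dots> \<le> (d + 85) * (card V + card E)" by (simp add: algebra_simps)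
    finally show ?thesis by (simp add: algebra_simps)
  qed
  ultimately show ?thesis
    using vu(1) unfolding exec_within_def by (meson le_trans)
qed

end

lemma efficient_imp_linear_time_constructible:
  assumes "efficient_model num model"
  shows "linear_time_constructible num model"
proof -
  from assms obtain pre q c d where model: "\<forall>V E es.
     simple_graph V E \<and> card E \<ge> 1 \<and> edge_list (num V) V E es \<longrightarrow>
     (\<exists>t s. exec pre (input_state (card V) es) t s \<and> t \<le> c * (card V + card E) \<and>
        answers q d {(i, j). i < card V \<and> j < card V \<and> i \<noteq> j}
          (\<lambda>i j. edge_prob (model V E) (num V i) (num V j)) (\<lambda>_. True) s)"
    unfolding efficient_model_def by (elim exE)
  define A where "A = vars pre \<union> vars q \<union> {''n'', ''m'', ''src'', ''dst'', ''i'', ''j'', ''out''}"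
  \<comment> \<open>Strings form an infinite type and \<open>A\<close> is finite. The fresh names
    depend only on \<open>pre\<close> and \<open>q\<close>, so the programs built from them serve
    all graphs.\<close>
  have "infinite (UNIV - A)"
    unfolding A_def by (intro Diff_infinite_finite infinite_UNIV_listI) (auto simp: finite_vars)
  then obtain x :: "nat \<Rightarrow> vname" where x: "inj x" "range x \<subseteq> UNIV - A"
    using infinite_countable_subset by blast
  interpret construction A pre q "x 0" "x 1" "x 2" "x 3" "x 4" "x 5" "x 6"
  proof unfold_locales
    show "vars pre \<subseteq> A" "vars q \<subseteq> A"
      "{''n'', ''m'', ''src'', ''dst'', ''i'', ''j'', ''out''} \<subseteq> A"
      unfolding A_def by blast+
    show "A \<inter> {x 0, x 1, x 2, x 3, x 4, x 5, x 6} = {}" using x(2) by blast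
    show "distinct [x 0, x 1, x 2, x 3, x 4, x 5, x 6]" by (simp add: inj_eq[OF x(1)])
  qed
  have graph: "\<exists>t s. exec build (input_state (card V) es) t s \<and> t \<le> (c + d + 85) * (card V + card E) \<and>
    answers weight_query (d + 14)
      {(i, j). i < card V \<and> j < card V \<and> {num V i, num V j} \<in> nsets V 2 - E}
      (\<lambda>i j. weight E (model V E) (num V i) (num V j))
      (stores_weighted_edges (x 0) (x 1) (x 2) (x 3) (x 5) (num V) V E (weight E (model V E))) s"
    if G: "simple_graph V E" "card E \<ge> 1" "edge_list (num V) V E es" for V E es
  proof -
    obtain t s where "exec pre (input_state (card V) es) t s" "t \<le> c * (card V + card E)"
      "answers q d {(i, j). i < card V \<and> j < card V \<and> i \<noteq> j}
        (\<lambda>i j. edge_prob (model V E) (num V i) (num V j)) (\<lambda>_. True) s"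
      using model G by blast
    then show ?thesis
      using build_weighted_graph[OF G, of c s d "model V E"] unfolding exec_within_def by blast
  qed
  \<comment> \<open>\<open>x 4\<close> and \<open>x 6\<close> are absent from the output names: they
    are the loop counter and the backup of \<open>out\<close>, not part of the represented
    graph.\<close>
  show ?thesis
    unfolding linear_time_constructible_def
    by (rule exI[of _ build], rule exI[of _ weight_query], rule exI[of _ "c + d + 85"],
        rule exI[of _ "d + 14"], rule exI[of _ "x 0"], rule exI[of _ "x 1"], rule exI[of _ "x 2"],
        rule exI[of _ "x 3"], rule exI[of _ "x 5"], intro allI impI, elim conjE, rule graph)
qed

theorem theorem1:
  fixes num :: "'a set \<Rightarrow> nat \<Rightarrow> 'a"
    and model :: "'a set \<Rightarrow> 'a set set \<Rightarrow> 'a set set pmf"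
  assumes numbering: "\<And>V. finite V \<Longrightarrow> bij_betw (num V) {..<card V} V"
    and random: "\<And>V E. simple_graph V E \<Longrightarrow> card E \<ge> 1 \<Longrightarrow> random_graph V (model V E)"
  shows "(efficient_model num model \<longrightarrow> linear_time_constructible num model) \<and>
    (\<forall>V E P. simple_graph V E \<and> card E \<ge> 1 \<and> partition_on V P \<longrightarrow>
       (is_arg_max (modularity E (model V E)) (partition_on V) P \<longleftrightarrow>
        is_arg_min (cut_weight V E (model V E)) (partition_on V) P))"
proof (intro conjI allI impI; (elim conjE)?)
  show "linear_time_constructible num model" if "efficient_model num model"
    using that by (rule efficient_imp_linear_time_constructible)
  show "is_arg_max (modularity E (model V E)) (partition_on V) P \<longleftrightarrow>
      is_arg_min (cut_weight V E (model V E)) (partition_on V) P"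
    if "simple_graph V E" "card E \<ge> 1" for V E P
    using that random[OF that] by (rule modularity_max_iff_cut_min)
qed

end
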